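(* Let $\Gamma=\Gamma(B)$ be the quiver of a cluster-tilted algebra of simply-laced Dynkin type $\Delta$, and let $\{\gamma_x : x\in\Gamma_0\}\subseteq\Phi$ be a companion basis for $\Gamma$. Then the companion bases for $\Gamma$ are precisely the sets of the form $\{\varepsilon_x w\sigma\gamma_x : x\in\Gamma_0\}$ (with $\varepsilon_x w\sigma\gamma_x$ the element indexed by $x$), where $w\in W_\Phi$, $\sigma$ is an orthogonal linear transformation of $V$ that permutes $\Pi$, and $\varepsilon_x\in\{\pm1\}$ for all $x\in\Gamma_0$.
   Context: Let $\Delta$ be a Dynkin diagram of type $A_n$, $D_n$, $E_6$, $E_7$ or $E_8$, with $n$ vertices. For a skew-symmetric integer matrix $B=(b_{xy})$ and an index $k$, the mutation of $B$ at $k$ is $B'=(b'_{xy})$ with $b'_{xy}=-b_{xy}$ if $x=k$ or $y=k$, and $b'_{xy}=b_{xy}+\frac{|b_{xk}|b_{ky}+b_{xk}|b_{ky}|}{2}$ otherwise; mutation equivalence means being connected by finitely many mutations. The Cartan counterpart of $B$ has diagonal entries $2$ and off-diagonal entries $-|b_{xy}|$. Fix a skew-symmetric integer matrix $B$, with rows and columns indexed by an $n$-element set $\Gamma_0$, which is an exchange matrix of the cluster algebra of type $\Delta$, i.e. $B$ is mutation equivalent to a matrix $B_0$ whose Cartan counterpart is the Cartan matrix of type $\Delta$. (All entries of $B$ then lie in $\{0,\pm1\}$.) Let $\Gamma=\Gamma(B)$ be the quiver with vertex set $\Gamma_0$ and an arrow $x\to y$ whenever $b_{xy}>0$; these are exactly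 the quivers of the cluster-tilted algebras of type $\Delta$. Let $V$ be a Euclidean space with positive definite symmetric bilinear form $(\;,\;)$, and let $\Phi\subseteq V$ be the root system of type $\Delta$ (spanning $V$), normalised so that $(\alpha,\alpha)=2$ for every root. Let $\Pi=\{\alpha_1,\dots,\alpha_n\}$ be a simple system of $\Phi$ and let $W_\Phi$ be the Weyl group. A quasi-Cartan companion of $B$ is a (here symmetric) integer matrix $A=(a_{xy})$ with $a_{xx}=2$ for all $x$ and $|a_{xy}|=|b_{xy}|$ for all $x\ne y$; it is positive if it is positive definite. A companion basis for $\Gamma$ is a subset $\{\gamma_x:x\in\Gamma_0\}\subseteq\Phi$, indexed by $\Gamma_0$, which is a $\mathbb Z$-basis of $\mathbb Z\Phi$ and is such that the matrix $A=(a_{xy})$ with $a_{xy}=(\gamma_x,\gamma_y)$ is a positive quasi-Cartan companion of $B$. *)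

theory Defs
  imports "HOL-Analysis.Analysis"
begin

section \<open>Simply-laced Dynkin types\<close>

datatype dynkin_type = Type_A nat | Type_D nat | Type_E6 | Type_E7 | Type_E8

fun dynkin_rank :: "dynkin_type \<Rightarrow> nat" where
  "dynkin_rank (Type_A n) = n"
| "dynkin_rank (Type_D n) = n"
| "dynkin_rank Type_E6 = 6"
| "dynkin_rank Type_E7 = 7"
| "dynkin_rank Type_E8 = 8"

text \<open>The indices for which \<^const>\<open>Type_A\<close> and \<^const>\<open>Type_D\<close> denote a Dynkin diagram.\<close>

fun valid_dynkin :: "dynkin_type \<Rightarrow> bool" where
  "valid_dynkin (Type_A n) \<longleftrightarrow> 1 \<le> n"
| "valid_dynkin (Type_D n) \<longleftrightarrow> 4 \<le> n"
| "valid_dynkin _ \<longleftrightarrow> True"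

text \<open>Bourbaki's labelling of the vertices by \<open>1, \<dots>, n\<close>.\<close>

fun dynkin_edges :: "dynkin_type \<Rightarrow> nat set set" where
  "dynkin_edges (Type_A n) = {{i, i + 1} |i. 1 \<le> i \<and> i + 1 \<le> n}"
| "dynkin_edges (Type_D n) = {{i, i + 1} |i. 1 \<le> i \<and> i + 1 \<le> n - 1} \<union> {{n - 2, n}}"
| "dynkin_edges Type_E6 = {{1,3}, {3,4}, {2,4}, {4,5}, {5,6}}"
| "dynkin_edges Type_E7 = {{1,3}, {3,4}, {2,4}, {4,5}, {5,6}, {6,7}}"
| "dynkin_edges Type_E8 = {{1,3}, {3,4}, {2,4}, {4,5}, {5,6}, {6,7}, {7,8}}"

definition dynkin_cartan :: "dynkin_type \<Rightarrow> nat \<Rightarrow> nat \<Rightarrow> int" where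
  "dynkin_cartan \<Delta> i j =
     (if i = j then 2 else if {i, j} \<in> dynkin_edges \<Delta> then -1 else 0)"

text \<open>Index sets carry no preferred numbering, so being the Cartan matrix of type \<open>\<Delta>\<close> is
  understood up to a bijection with the vertices of the diagram.\<close>

definition is_cartan_matrix_of_type :: "dynkin_type \<Rightarrow> int ^ 'n ^ 'n \<Rightarrow> bool" where
  "is_cartan_matrix_of_type \<Delta> C \<longleftrightarrow>
     (\<exists>l. bij_betw l UNIV {1..dynkin_rank \<Delta>} \<and>
          (\<forall>x y. C $ x $ y = dynkin_cartan \<Delta> (l x) (l y)))"


section \<open>Matrix mutation\<close>

definition skew_symmetric :: "int ^ 'n ^ 'n \<Rightarrow> bool" where
  "skew_symmetric B \<longleftrightarrow> transpose B = - B"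

text \<open>The integer division is exact: the dividend is \<open>0\<close> or \<open>\<plusminus> 2 b\<^sub>x\<^sub>k b\<^sub>k\<^sub>y\<close>.\<close>

definition mutate :: "'n \<Rightarrow> int ^ 'n ^ 'n \<Rightarrow> int ^ 'n ^ 'n" where
  "mutate k B = (\<chi> x y.
     if x = k \<or> y = k then - B $ x $ y
     else B $ x $ y + (\<bar>B $ x $ k\<bar> * B $ k $ y + B $ x $ k * \<bar>B $ k $ y\<bar>) div 2)"

text \<open>No symmetric closure is needed, since \<^term>\<open>mutate k\<close> is an involution.\<close>

definition mutation_equivalent :: "int ^ 'n ^ 'n \<Rightarrow> int ^ 'n ^ 'n \<Rightarrow> bool" where
  "mutation_equivalent = (\<lambda>B B'. \<exists>k. B' = mutate k B)\<^sup>*\<^sup>*"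

definition cartan_counterpart :: "int ^ 'n ^ 'n \<Rightarrow> int ^ 'n ^ 'n" where
  "cartan_counterpart B = (\<chi> x y. if x = y then 2 else - \<bar>B $ x $ y\<bar>)"

definition exchange_matrix_of_type :: "dynkin_type \<Rightarrow> int ^ 'n ^ 'n \<Rightarrow> bool" where
  "exchange_matrix_of_type \<Delta> B \<longleftrightarrow> skew_symmetric B \<and>
     (\<exists>B\<^sub>0. mutation_equivalent B B\<^sub>0 \<and> is_cartan_matrix_of_type \<Delta> (cartan_counterpart B\<^sub>0))"


section \<open>Root systems\<close>

definition reflection :: "'a::euclidean_space \<Rightarrow> 'a \<Rightarrow> 'a" where
  "reflection \<alpha> v = v - (2 * (v \<bullet> \<alpha>) / (\<alpha> \<bullet> \<alpha>)) *\<^sub>R \<alpha>"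

definition root_system :: "'a::euclidean_space set \<Rightarrow> bool" where
  "root_system \<Phi> \<longleftrightarrow>
     finite \<Phi> \<and> 0 \<notin> \<Phi> \<and> span \<Phi> = UNIV \<and>
     (\<forall>\<alpha>\<in>\<Phi>. \<forall>c. c *\<^sub>R \<alpha> \<in> \<Phi> \<longrightarrow> c = 1 \<or> c = -1) \<and>
     (\<forall>\<alpha>\<in>\<Phi>. reflection \<alpha> ` \<Phi> = \<Phi>) \<and>
     (\<forall>\<alpha>\<in>\<Phi>. \<forall>\<beta>\<in>\<Phi>. 2 * (\<beta> \<bullet> \<alpha>) / (\<alpha> \<bullet> \<alpha>) \<in> \<int>)"

definition simple_system :: "'a::euclidean_space set \<Rightarrow> 'a set \<Rightarrow> bool" where
  "simple_system \<Phi> S \<longleftrightarrow>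
     S \<subseteq> \<Phi> \<and> independent S \<and>
     (\<forall>\<beta>\<in>\<Phi>. \<exists>c :: 'a \<Rightarrow> nat.
        \<beta> = (\<Sum>\<alpha>\<in>S. real (c \<alpha>) *\<^sub>R \<alpha>) \<or> \<beta> = - (\<Sum>\<alpha>\<in>S. real (c \<alpha>) *\<^sub>R \<alpha>))"

text \<open>The type is read off from the Cartan matrix of some simple system; it does not depend on
  which one, because any two simple systems are conjugate under the Weyl group.\<close>

definition root_system_of_type :: "dynkin_type \<Rightarrow> 'a::euclidean_space set \<Rightarrow> bool" where
  "root_system_of_type \<Delta> \<Phi> \<longleftrightarrow> root_system \<Phi> \<and>
     (\<exists>S l. simple_system \<Phi> S \<and> bij_betw l S {1..dynkin_rank \<Delta>} \<and>
        (\<forall>\<alpha>\<in>S. \<forall>\<beta>\<in>S.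
           2 * (\<alpha> \<bullet> \<beta>) / (\<beta> \<bullet> \<beta>) = of_int (dynkin_cartan \<Delta> (l \<alpha>) (l \<beta>))))"

text \<open>Closure under inverses is automatic, since reflections are involutions.\<close>

inductive_set weyl_group :: "'a::euclidean_space set \<Rightarrow> ('a \<Rightarrow> 'a) set" for \<Phi> where
  "id \<in> weyl_group \<Phi>"
| "\<alpha> \<in> \<Phi> \<Longrightarrow> w \<in> weyl_group \<Phi> \<Longrightarrow> reflection \<alpha> \<circ> w \<in> weyl_group \<Phi>"


section \<open>Companion bases\<close>

abbreviation int_scale :: "int \<Rightarrow> 'a::real_vector \<Rightarrow> 'a" where
  "int_scale k v \<equiv> of_int k *\<^sub>R v"

lemma module_int_scale: "Modules.module int_scale"
  by unfold_locales (simp_all add: scaleR_add_right scaleR_add_left)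

definition is_int_basis :: "('n \<Rightarrow> 'a::real_vector) \<Rightarrow> 'a set \<Rightarrow> bool" where
  "is_int_basis \<gamma> L \<longleftrightarrow>
     inj \<gamma> \<and> module.independent int_scale (range \<gamma>) \<and> module.span int_scale (range \<gamma>) = L"

definition quasi_cartan_companion :: "int ^ 'n ^ 'n \<Rightarrow> int ^ 'n ^ 'n \<Rightarrow> bool" where
  "quasi_cartan_companion B A \<longleftrightarrow>
     transpose A = A \<and> (\<forall>x. A $ x $ x = 2) \<and> (\<forall>x y. x \<noteq> y \<longrightarrow> \<bar>A $ x $ y\<bar> = \<bar>B $ x $ y\<bar>)"

definition positive_definite :: "int ^ 'n ^ 'n \<Rightarrow> bool" where
  "positive_definite A \<longleftrightarrow>
     (\<forall>v :: real ^ 'n. v \<noteq> 0 \<longrightarrow> v \<bullet> ((\<chi> x y. real_of_int (A $ x $ y)) *v v) > 0)"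

text \<open>Companion bases of the quiver \<open>\<Gamma>(B)\<close>, as families indexed by its vertices. The quiver enters
  through \<^term>\<open>B\<close>: only the absolute values of the entries of \<^term>\<open>B\<close> matter.\<close>

definition companion_basis ::
    "'a::euclidean_space set \<Rightarrow> int ^ 'n ^ 'n \<Rightarrow> ('n \<Rightarrow> 'a) \<Rightarrow> bool" where
  "companion_basis \<Phi> B \<gamma> \<longleftrightarrow>
     range \<gamma> \<subseteq> \<Phi> \<and> is_int_basis \<gamma> (module.span int_scale \<Phi>) \<and>
     (\<exists>A. (\<forall>x y. of_int (A $ x $ y) = \<gamma> x \<bullet> \<gamma> y) \<and>
          quasi_cartan_companion B A \<and> positive_definite A)"

end

theory Submission
  imports Defs
begin

text \<open>Two companion bases \<open>\<gamma>\<close>, \<open>\<gamma>'\<close> of the same quiver have Gram matrices that agree up to the signs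
  of their entries. The heart of the matter is that positivity fixes these signs up to replacing
  some vectors by their negatives. Around a chordless cycle the sign of the product of the entries
  cannot be arbitrary: after sign changes the vectors of a path in the cycle have consecutive inner
  products \<open>-1\<close>, so their sum has norm \<open>2\<close> again; if the remaining vertex of the cycle paired with
  this sum to \<open>\<plusminus> 2\<close>, it would be equal to plus or minus the sum, against linear independence
  (\<open>chordless_cycle_sign\<close>). So both Gram matrices have the same product around every chordless
  cycle, and therefore they differ by a change of signs \<open>\<epsilon>\<close> (\<open>gram_sign_equivalent_on\<close>): the
  ratio of two entries must be multiplicatively trivial around every closed walk, and a shortest
  violation is a chordless cycle.

  Hence \<open>\<gamma>\<^sub>x \<mapsto> \<epsilon>\<^sub>x \<gamma>'\<^sub>x\<close> extends to an isometry \<open>T\<close> of the space that preserves the root lattice.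
  In the simply-laced case the roots are exactly the lattice vectors of norm \<open>2\<close>
  (\<open>norm_two_lattice_vector_is_root\<close>), so \<open>T\<close> permutes the roots and carries the simple system \<open>S\<close>
  to a simple system \<open>T S\<close>. Simple systems are conjugate under the Weyl group
  (\<open>simple_systems_conjugate\<close>); if \<open>w S = T S\<close>, then \<open>\<sigma> = w\<inverse> T\<close> permutes \<open>S\<close> and \<open>T = w \<sigma>\<close>.
  Conversely, \<open>w\<close> and \<open>\<sigma>\<close> preserve the root lattice and hence the roots, and neither isometries
  nor sign changes alter the absolute values of the inner products.\<close>


section \<open>Signs in positive quasi-Cartan matrices\<close>

text \<open>An integer matrix is a positive definite symmetric quasi-Cartan matrix if and only if it is the
  Gram matrix of such a family. Working with the vectors instead of the matrix turns statements about the
  quadratic form into statements about norms.\<close>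
definition norm_two_frame :: "('n::finite \<Rightarrow> 'a::euclidean_space) \<Rightarrow> bool" where
  "norm_two_frame g \<longleftrightarrow> inj g \<and> independent (range g) \<and>
     (\<forall>x. g x \<bullet> g x = 2) \<and> (\<forall>x y. g x \<bullet> g y \<in> \<int>)"

lemma norm_two_inner_cases:
  fixes u v :: "'a::real_inner"
  assumes "u \<bullet> u = 2" "v \<bullet> v = 2" "u \<bullet> v \<in> \<int>"
  shows "u \<bullet> v \<in> {-1, 0, 1} \<or> u \<bullet> v = 2 \<and> u = v \<or> u \<bullet> v = -2 \<and> u = - v"
proof -
  have p: "(u + v) \<bullet> (u + v) = 4 + 2 * (u \<bullet> v)" and m: "(u - v) \<bullet> (u - v) = 4 - 2 * (u \<bullet> v)"
    using assms by (simp_all add: algebra_simps inner_commute)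
  obtain k where k: "u \<bullet> v = of_int k" using assms(3) by (auto elim: Ints_cases)
  have "-2 \<le> u \<bullet> v" "u \<bullet> v \<le> 2"
    using p m inner_ge_zero[of "u + v"] inner_ge_zero[of "u - v"] by linarith+
  then have "k \<in> {-2, -1, 0, 1, 2}" using k by auto
  moreover have "u = v" if "u \<bullet> v = 2" using m that by simp
  moreover have "u = - v" if "u \<bullet> v = -2" using p that by (simp add: eq_neg_iff_add_eq_0)
  ultimately show ?thesis using k by auto
qed

lemma norm_two_frame_inner:
  assumes "norm_two_frame g" "x \<noteq> y"
  shows "g x \<bullet> g y \<in> {-1, 0, 1}"
proof -
  have ne: "g x \<noteq> g y" using assms by (auto simp: norm_two_frame_def inj_def)
  have "g x \<noteq> - g y"
  proof
    assume "g x = - g y"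
    moreover have "g y \<in> span (range g - {g x})" using ne by (intro span_base) auto
    ultimately have "g x \<in> span (range g - {g x})" by (metis span_neg)
    then show False using assms(1) unfolding norm_two_frame_def dependent_def by blast
  qed
  then show ?thesis
    using norm_two_inner_cases[of "g x" "g y"] assms(1) ne by (auto simp: norm_two_frame_def)
qed

text \<open>The sign to give to the \<open>i\<close>-th vector of a path so that consecutive vectors have inner product
  \<open>-1\<close>, the first vector keeping its sign.\<close>
definition path_sign :: "('n \<Rightarrow> 'a::real_inner) \<Rightarrow> (nat \<Rightarrow> 'n) \<Rightarrow> nat \<Rightarrow> real" where
  "path_sign g f i = (\<Prod>j<i. - (g (f j) \<bullet> g (f (Suc j))))"

text \<open>The next vector of the path meets only the last summand, and with the chosen sign their inner
  product is \<open>-1\<close>; so the norm stays \<open>2 + 2 - 2 = 2\<close>.\<close>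
lemma chordless_path_sum_norm:
  assumes "norm_two_frame g"
    and step: "\<And>i. i < k \<Longrightarrow> g (f i) \<bullet> g (f (Suc i)) \<in> {-1, 1}"
    and chord: "\<And>i j. Suc i < j \<Longrightarrow> j \<le> k \<Longrightarrow> g (f i) \<bullet> g (f j) = 0"
  defines "u \<equiv> \<lambda>m. \<Sum>i\<le>m. path_sign g f i *\<^sub>R g (f i)"
  shows "m \<le> k \<Longrightarrow> u m \<bullet> u m = 2 \<and> path_sign g f m \<in> {-1, 1}"
proof (induction m)
  case 0
  then show ?case using assms(1) by (simp add: u_def path_sign_def norm_two_frame_def)
next
  case (Suc m)
  let ?s = "path_sign g f" and ?a = "g (f m) \<bullet> g (f (Suc m))"
  have s: "?s (Suc m) = - ?a * ?s m" by (simp add: path_sign_def)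
  have a: "?a \<in> {-1, 1}" and sm: "?s m \<in> {-1, 1}" using step Suc by auto
  have "u m \<bullet> g (f (Suc m)) = (\<Sum>i\<le>m. ?s i * (g (f i) \<bullet> g (f (Suc m))))"
    by (simp add: u_def inner_sum_left)
  also have "\<dots> = (\<Sum>i\<le>m. if i = m then ?s m * ?a else 0)"
    using chord Suc.prems by (intro sum.cong) auto
  finally have um: "u m \<bullet> g (f (Suc m)) = ?s m * ?a" by simp
  have "u (Suc m) = u m + ?s (Suc m) *\<^sub>R g (f (Suc m))" by (simp add: u_def)
  then have "u (Suc m) \<bullet> u (Suc m) = u m \<bullet> u m + 2 * ?s (Suc m) * (u m \<bullet> g (f (Suc m)))
      + ?s (Suc m) * ?s (Suc m) * (g (f (Suc m)) \<bullet> g (f (Suc m)))"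
    by (simp add: algebra_simps inner_commute)
  then show ?case
    using a sm s um Suc assms(1) by (auto simp: norm_two_frame_def)
qed

text \<open>Let \<open>u\<close> be the signed sum of the path. Both \<open>u\<close> and \<open>g v\<close> have norm \<open>2\<close> and they are linearly
  independent, so their inner product is at most \<open>1\<close> in absolute value. It is a sum of two signs,
  hence \<open>0\<close>: the cycle closed by \<open>v\<close> leaves no choice for the last sign.\<close>
lemma chordless_cycle_sign:
  assumes g: "norm_two_frame g"
    and step: "\<And>i. i < k \<Longrightarrow> g (f i) \<bullet> g (f (Suc i)) \<in> {-1, 1}"
    and chord: "\<And>i j. Suc i < j \<Longrightarrow> j \<le> k \<Longrightarrow> g (f i) \<bullet> g (f j) = 0"
    and k: "0 < k"
    and v: "\<And>i. i \<le> k \<Longrightarrow> f i \<noteq> v"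
    and ends: "g v \<bullet> g (f 0) \<noteq> 0" "g v \<bullet> g (f k) \<noteq> 0"
    and inner: "\<And>i. 0 < i \<Longrightarrow> i < k \<Longrightarrow> g v \<bullet> g (f i) = 0"
  shows "g v \<bullet> g (f k) = - path_sign g f k * (g v \<bullet> g (f 0))"
proof -
  let ?s = "path_sign g f"
  define u where "u = (\<Sum>i\<le>k. ?s i *\<^sub>R g (f i))"
  have u2: "u \<bullet> u = 2" and sk: "?s k \<in> {-1, 1}"
    using chordless_path_sum_norm[of g k f k] g step chord by (auto simp: u_def)
  have "g v \<bullet> u = (\<Sum>i\<le>k. ?s i * (g v \<bullet> g (f i)))" by (simp add: u_def inner_sum_right)
  also have "\<dots> = (\<Sum>i\<in>{0, k}. ?s i * (g v \<bullet> g (f i)))"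
    using inner by (intro sum.mono_neutral_right) auto
  finally have gu: "g v \<bullet> u = g v \<bullet> g (f 0) + ?s k * (g v \<bullet> g (f k))"
    using k by (simp add: path_sign_def)
  have "g v \<notin> span (range g - {g v})"
    using g unfolding norm_two_frame_def dependent_def by blast
  moreover have "u \<in> span (range g - {g v})"
    unfolding u_def using v g
    by (intro span_sum span_scale span_base) (auto simp: norm_two_frame_def inj_def)
  ultimately have "g v \<noteq> u" "g v \<noteq> - u" using span_neg by metis+
  moreover have "g v \<bullet> u \<in> \<int>" using gu sk g by (auto simp: norm_two_frame_def)
  ultimately have "g v \<bullet> u \<in> {-1, 0, 1}"
    using norm_two_inner_cases[of "g v" u] u2 g by (auto simp: norm_two_frame_def)
  then show ?thesis
    using gu sk ends norm_two_frame_inner[OF g, of v "f 0"] norm_two_frame_inner[OF g, of v "f k"]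
      v[of 0] v[of k] by auto
qed

definition adjacency :: "('n \<Rightarrow> 'a::real_inner) \<Rightarrow> 'n set \<Rightarrow> 'n rel" where
  "adjacency g Y = {(x, y). x \<in> Y \<and> y \<in> Y \<and> x \<noteq> y \<and> g x \<bullet> g y \<noteq> 0}"

text \<open>Suppose that two Gram matrices agree on \<open>Y\<close> and agree up to signs in the row of \<open>v\<close>. Along a
  walk in \<open>Y\<close> between two neighbours of \<open>v\<close> the ratio of the two rows cannot change. By induction
  on the length the walk may be assumed to have no repeated vertex, no chord, and no neighbour of
  \<open>v\<close> in its interior. Then \<open>v\<close> closes it to a chordless cycle, where both rows are governed by
  the same path sign.\<close>
lemma attachment_ratio_constant:
  fixes g h :: "'n::finite \<Rightarrow> 'a::euclidean_space"
  assumes g: "norm_two_frame g" and h: "norm_two_frame h"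
    and agree: "\<And>x y. x \<in> Y \<Longrightarrow> y \<in> Y \<Longrightarrow> h x \<bullet> h y = g x \<bullet> g y"
    and v: "v \<notin> Y" and abs: "\<And>x. \<bar>h v \<bullet> h x\<bar> = \<bar>g v \<bullet> g x\<bar>"
  shows "(x, y) \<in> adjacency g Y ^^ k \<Longrightarrow> x \<in> Y \<Longrightarrow> g v \<bullet> g x \<noteq> 0 \<Longrightarrow> g v \<bullet> g y \<noteq> 0 \<Longrightarrow>
    (g v \<bullet> g x) * (h v \<bullet> h x) = (g v \<bullet> g y) * (h v \<bullet> h y)"
proof (induction k arbitrary: x y rule: less_induct)
  case (less k)
  let ?R = "adjacency g Y"
  \<comment> \<open>The entries on edges are \<open>\<plusminus> 1\<close>, so this product is the ratio of the two rows.\<close>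
  let ?d = "\<lambda>x. (g v \<bullet> g x) * (h v \<bullet> h x)"
  obtain f where f0: "f 0 = x" and fk: "f k = y"
    and fR: "\<And>i. i < k \<Longrightarrow> (f i, f (Suc i)) \<in> ?R"
    using less.prems(1) by (auto simp: relpow_fun_conv)
  have sub: "(f i, f j) \<in> ?R ^^ (j - i)" if "i \<le> j" "j \<le> k" for i j
    unfolding relpow_fun_conv using that fR by (intro exI[of _ "\<lambda>m. f (i + m)"]) auto
  have fY: "f i \<in> Y" if "i \<le> k" for i
    using that fR[of "i - 1"] less.prems(2) f0 by (cases i) (auto simp: adjacency_def)
  show ?case
  proof (cases "k = 0")
    case True
    then show ?thesis using f0 fk by simp
  next
    case k: False
    show ?thesis
    proof (cases "\<exists>i. 0 < i \<and> i < k \<and> g v \<bullet> g (f i) \<noteq> 0")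
      case True
      then obtain i where i: "0 < i" "i < k" "g v \<bullet> g (f i) \<noteq> 0" by blast
      have "?d x = ?d (f i)"
        using less.IH[of i x "f i"] sub[of 0 i] i less.prems f0 by auto
      moreover have "?d (f i) = ?d y"
        using less.IH[of "k - i" "f i" y] sub[of i k] i less.prems fk fY by auto
      ultimately show ?thesis by simp
    next
      case inner: False
      show ?thesis
      proof (cases "\<exists>i j. i < j \<and> j \<le> k \<and> (f i = f j \<or> Suc i < j \<and> (f i, f j) \<in> ?R)")
        case True
        then obtain i j where ij: "i < j" "j \<le> k" "f i = f j \<or> Suc i < j \<and> (f i, f j) \<in> ?R"
          by blast
        \<comment> \<open>Cut out the part of the walk from \<open>i\<close> to \<open>j\<close>; a chord costs one step, a repetition none.\<close>
        define m where "m = (if f i = f j then 0 else 1 :: nat)"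
        have "(f i, f j) \<in> ?R ^^ m" "i + m < j" using ij by (auto simp: m_def)
        then have "(x, y) \<in> ?R ^^ (i + m + (k - j))"
          using sub[of 0 i] sub[of j k] ij f0 fk unfolding relpow_add by auto
        moreover have "i + m + (k - j) < k" using \<open>i + m < j\<close> ij by simp
        ultimately show ?thesis using less by blast
      next
        case False
        then have chord: "g (f i) \<bullet> g (f j) = 0" if "Suc i < j" "j \<le> k" for i j
        proof -
          have "f i \<noteq> f j" "(f i, f j) \<notin> ?R" using False that Suc_lessD by blast+
          then show ?thesis using that fY[of i] fY[of j] by (auto simp: adjacency_def)
        qed
        have inner0: "g v \<bullet> g (f i) = 0" if "0 < i" "i < k" for i using inner that by blast
        have step: "g (f i) \<bullet> g (f (Suc i)) \<in> {-1, 1}" if "i < k" for i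
          using fR[OF that] norm_two_frame_inner[OF g, of "f i" "f (Suc i)"]
          by (auto simp: adjacency_def)
        have hz: "(h v \<bullet> h z = 0) = (g v \<bullet> g z = 0)" for z using abs[of z] by auto
        have fv: "f i \<noteq> v" if "i \<le> k" for i using fY[OF that] v by auto
        have "g v \<bullet> g y = - path_sign g f k * (g v \<bullet> g x)"
          using chordless_cycle_sign[OF g, of k f v] step chord k fv inner0 less.prems f0 fk by auto
        moreover have "h v \<bullet> h y = - path_sign h f k * (h v \<bullet> h x)"
          using chordless_cycle_sign[OF h, of k f v] step chord k fv inner0 less.prems f0 fk
            agree fY hz by auto
        moreover have "path_sign h f k = path_sign g f k"
          unfolding path_sign_def using agree fY by (intro prod.cong) auto
        moreover have "path_sign g f k \<in> {-1, 1}"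
          using chordless_path_sum_norm[of g k f k] g step chord by auto
        ultimately show ?thesis by auto
      qed
    qed
  qed
qed

lemma norm_two_frame_sign_change:
  fixes \<epsilon> :: "'n::finite \<Rightarrow> real"
  assumes "norm_two_frame g" and "\<And>x. \<epsilon> x \<in> {1, -1}"
  shows "norm_two_frame (\<lambda>x. \<epsilon> x *\<^sub>R g x)"
proof -
  have ind: "\<epsilon> x *\<^sub>R g x \<notin> span ((\<lambda>x. \<epsilon> x *\<^sub>R g x) ` (- {x}))" for x
  proof
    have "span ((\<lambda>x. \<epsilon> x *\<^sub>R g x) ` (- {x})) \<subseteq> span (range g - {g x})"
    proof (intro span_minimal subspace_span image_subsetI span_scale span_base)
      fix y assume "y \<in> - {x}"
      then show "g y \<in> range g - {g x}" using assms(1) by (auto simp: norm_two_frame_def inj_def)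
    qed
    moreover assume "\<epsilon> x *\<^sub>R g x \<in> span ((\<lambda>x. \<epsilon> x *\<^sub>R g x) ` (- {x}))"
    ultimately have "\<epsilon> x *\<^sub>R \<epsilon> x *\<^sub>R g x \<in> span (range g - {g x})"
      using span_scale by blast
    then have "g x \<in> span (range g - {g x})" using assms(2)[of x] by auto
    then show False using assms(1) unfolding norm_two_frame_def dependent_def by blast
  qed
  have inj: "inj (\<lambda>x. \<epsilon> x *\<^sub>R g x)"
  proof (rule injI, rule ccontr)
    fix x y assume *: "\<epsilon> x *\<^sub>R g x = \<epsilon> y *\<^sub>R g y" "x \<noteq> y"
    then have "\<epsilon> x *\<^sub>R g x \<in> span ((\<lambda>x. \<epsilon> x *\<^sub>R g x) ` (- {x}))"
      by (auto intro!: span_base)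
    then show False using ind by blast
  qed
  have "independent (range (\<lambda>x. \<epsilon> x *\<^sub>R g x))"
    unfolding dependent_def
  proof (clarify)
    fix x
    assume "\<epsilon> x *\<^sub>R g x \<in> span (range (\<lambda>x. \<epsilon> x *\<^sub>R g x) - {\<epsilon> x *\<^sub>R g x})"
    moreover have "range (\<lambda>x. \<epsilon> x *\<^sub>R g x) - {\<epsilon> x *\<^sub>R g x} \<subseteq> (\<lambda>x. \<epsilon> x *\<^sub>R g x) ` (- {x})"
      by auto
    ultimately show False using ind span_mono by blast
  qed
  moreover have "\<epsilon> y * (\<epsilon> x * (g x \<bullet> g y)) \<in> \<int>" "\<epsilon> x * \<epsilon> x = 1" for x y
    using assms(2)[of x] assms(2)[of y] assms(1) by (auto simp: norm_two_frame_def)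
  ultimately show ?thesis
    using inj assms(1) by (auto simp: norm_two_frame_def mult.assoc[symmetric])
qed

text \<open>Vertices are added one at a time. After the signs found for \<open>Y\<close> have been applied, the two Gram
  matrices agree on \<open>Y\<close>; the new vertex \<open>v\<close> is fitted by flipping those connected components of
  \<open>Y\<close> in which the rows of \<open>v\<close> disagree. This is consistent because the ratio of the rows is
  constant on the neighbours of \<open>v\<close> in a component.\<close>
lemma gram_sign_equivalent_on:
  fixes g h :: "'n::finite \<Rightarrow> 'a::euclidean_space"
  assumes g: "norm_two_frame g" and h: "norm_two_frame h"
    and abs: "\<And>x y. \<bar>h x \<bullet> h y\<bar> = \<bar>g x \<bullet> g y\<bar>"
  shows "\<exists>\<epsilon> :: 'n \<Rightarrow> real. (\<forall>x. \<epsilon> x \<in> {1, -1}) \<and>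
    (\<forall>x\<in>Y. \<forall>y\<in>Y. \<epsilon> x * \<epsilon> y * (h x \<bullet> h y) = g x \<bullet> g y)"
  using finite[of Y]
proof (induction Y rule: finite_induct)
  case empty
  show ?case by (intro exI[of _ "\<lambda>_. 1"]) auto
next
  case (insert v Y)
  obtain \<epsilon> :: "'n \<Rightarrow> real" where \<epsilon>: "\<And>x. \<epsilon> x \<in> {1, -1}"
    and eq: "\<And>x y. x \<in> Y \<Longrightarrow> y \<in> Y \<Longrightarrow> \<epsilon> x * \<epsilon> y * (h x \<bullet> h y) = g x \<bullet> g y"
    using insert.IH by blast
  define h' where "h' x = \<epsilon> x *\<^sub>R h x" for x
  have h': "norm_two_frame h'"
    using norm_two_frame_sign_change[OF h, of \<epsilon>] \<epsilon> by (simp add: h'_def[abs_def])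
  have h'_inner: "h' x \<bullet> h' y = \<epsilon> x * \<epsilon> y * (h x \<bullet> h y)" for x y by (simp add: h'_def)
  have abs': "\<bar>h' x \<bullet> h' y\<bar> = \<bar>g x \<bullet> g y\<bar>" for x y
    using \<epsilon>[of x] \<epsilon>[of y] abs[of x y] by (auto simp: h'_inner)
  let ?R = "adjacency g Y" and ?d = "\<lambda>x. (g v \<bullet> g x) * (h' v \<bullet> h' x)"
  have R_sym: "(y, x) \<in> ?R" if "(x, y) \<in> ?R" for x y
    using that by (auto simp: adjacency_def inner_commute)
  \<comment> \<open>\<open>\<eta>\<close> flips exactly the components of \<open>Y\<close> that contain a neighbour of \<open>v\<close> with ratio \<open>-1\<close>.\<close>
  define \<eta> :: "'n \<Rightarrow> real" where "\<eta> x =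
    (if x \<in> Y \<and> (\<exists>z. (x, z) \<in> ?R\<^sup>* \<and> ?d z = -1) then -1 else 1)" for x
  have \<eta>: "\<eta> x \<in> {1, -1}" for x by (simp add: \<eta>_def)
  have \<eta>_adj: "\<eta> x = \<eta> y" if "(x, y) \<in> ?R" for x y
    using that R_sym[OF that] converse_rtrancl_into_rtrancl
    unfolding \<eta>_def by (metis (no_types, lifting) adjacency_def case_prodD mem_Collect_eq)
  have "\<eta> x * \<eta> y * (h' x \<bullet> h' y) = g x \<bullet> g y" if "x \<in> Y" "y \<in> Y" for x y
  proof (cases "(x, y) \<in> ?R \<or> x = y")
    case True
    then have "\<eta> x = \<eta> y" using \<eta>_adj by auto
    then show ?thesis using \<eta>[of y] eq[OF that] by (auto simp: h'_inner)
  next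
    case False
    then have "g x \<bullet> g y = 0" using that by (auto simp: adjacency_def)
    then show ?thesis using abs'[of x y] by simp
  qed
  moreover have v1: "\<eta> v = 1" using insert.hyps by (simp add: \<eta>_def)
  moreover have vx: "\<eta> x * (h' v \<bullet> h' x) = g v \<bullet> g x" if "x \<in> Y" for x
  proof (cases "g v \<bullet> g x = 0")
    case True
    then show ?thesis using abs'[of v x] by simp
  next
    case nz: False
    have "g v \<bullet> g x \<in> {-1, 1}"
      using norm_two_frame_inner[OF g, of v x] nz that insert.hyps by auto
    then have d: "?d x \<in> {-1, 1}"
      using abs'[of v x] by auto
    have const: "?d x = ?d z" if z: "(x, z) \<in> ?R\<^sup>*" "?d z = -1" for z
    proof -
      obtain k where "(x, z) \<in> ?R ^^ k" using z(1) rtrancl_power by blast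
      moreover have "g v \<bullet> g z \<noteq> 0" using z(2) by auto
      ultimately show ?thesis
        using attachment_ratio_constant[OF g h', of Y v x z k] eq insert.hyps abs' nz \<open>x \<in> Y\<close>
        by (auto simp: h'_inner)
    qed
    have "\<eta> x = ?d x"
    proof (cases "?d x = -1")
      case True
      then show ?thesis using that by (auto simp: \<eta>_def)
    next
      case False
      then have "\<not> (\<exists>z. (x, z) \<in> ?R\<^sup>* \<and> ?d z = -1)" using const by force
      then show ?thesis using d False by (auto simp: \<eta>_def)
    qed
    moreover have "h' v \<bullet> h' x \<in> {-1, 1}"
      using \<open>g v \<bullet> g x \<in> {-1, 1}\<close> abs'[of v x] by (auto simp: abs_if split: if_splits)
    ultimately show ?thesis using \<open>g v \<bullet> g x \<in> {-1, 1}\<close> by auto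
  qed
  moreover have "g x \<bullet> g x = 2" "h' x \<bullet> h' x = 2" for x
    using g h' by (auto simp: norm_two_frame_def)
  ultimately have "\<eta> x * \<eta> y * (h' x \<bullet> h' y) = g x \<bullet> g y"
    if "x \<in> insert v Y" "y \<in> insert v Y" for x y
    using that by (auto simp: inner_commute[of "h' _" "h' v"] inner_commute[of "g _" "g v"])
  moreover have "\<eta> x * \<epsilon> x \<in> {1, -1}" for x using \<eta>[of x] \<epsilon>[of x] by auto
  ultimately show ?case
    by (intro exI[of _ "\<lambda>x. \<eta> x * \<epsilon> x"]) (simp add: h'_inner mult_ac)
qed


section \<open>Root lattices\<close>

abbreviation int_span :: "'a::real_vector set \<Rightarrow> 'a set" where
  "int_span \<equiv> module.span int_scale"

interpretation int_module: Modules.module "int_scale :: int \<Rightarrow> 'a \<Rightarrow> 'a::real_vector"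
  by (rule module_int_scale)

lemma int_span_linear_image:
  assumes "linear T"
  shows "int_span (T ` X) = T ` int_span X"
proof -
  interpret T: linear T by (rule assms)
  have "module_hom int_scale int_scale T"
    by unfold_locales (simp_all add: T.add T.scale)
  then show ?thesis by (rule module_hom.span_image)
qed

lemma span_int_span: "span (int_span X) = span X"
proof -
  have "int_span X \<subseteq> span X"
    by (intro int_module.span_minimal span_superset)
      (auto simp: int_module.subspace_def span_zero span_add span_scale)
  then show ?thesis
    by (metis int_module.span_superset span_mono span_span subset_antisym)
qed


section \<open>Simply-laced root systems and their simple systems\<close>

definition norm_two_root_system :: "'a::euclidean_space set \<Rightarrow> bool" where
  "norm_two_root_system \<Phi> \<longleftrightarrow> root_system \<Phi> \<and> (\<forall>\<alpha>\<in>\<Phi>. \<alpha> \<bullet> \<alpha> = 2)"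

context
  fixes \<Phi> :: "'a::euclidean_space set"
  assumes \<Phi>: "norm_two_root_system \<Phi>"
begin

lemma root_norm: "\<alpha> \<in> \<Phi> \<Longrightarrow> \<alpha> \<bullet> \<alpha> = 2"
  using \<Phi> by (simp add: norm_two_root_system_def)

lemma finite_roots: "finite \<Phi>" and span_roots: "span \<Phi> = UNIV"
  using \<Phi> by (simp_all add: norm_two_root_system_def root_system_def)

lemma reflection_root: "\<alpha> \<in> \<Phi> \<Longrightarrow> reflection \<alpha> v = v - (v \<bullet> \<alpha>) *\<^sub>R \<alpha>"
  by (simp add: reflection_def root_norm)

lemma reflection_roots: "\<alpha> \<in> \<Phi> \<Longrightarrow> reflection \<alpha> ` \<Phi> = \<Phi>"
  using \<Phi> by (simp add: norm_two_root_system_def root_system_def)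

lemma root_inner_Ints: "\<alpha> \<in> \<Phi> \<Longrightarrow> \<beta> \<in> \<Phi> \<Longrightarrow> \<alpha> \<bullet> \<beta> \<in> \<int>"
  using \<Phi> root_norm[of \<beta>] by (auto simp: norm_two_root_system_def root_system_def)

lemma uminus_root: "\<alpha> \<in> \<Phi> \<Longrightarrow> - \<alpha> \<in> \<Phi>"
  using reflection_roots[of \<alpha>] reflection_root[of \<alpha> \<alpha>] root_norm[of \<alpha>]
  by (metis (no_types, lifting) add_diff_cancel_right' diff_add_cancel diff_minus_eq_add
      imageI minus_diff_eq scaleR_2)

text \<open>Descent on the sum of the absolute values of the coefficients in an expression
  \<open>v = \<Sum> c\<^sub>\<alpha> \<alpha>\<close>. As \<open>(v, v) > 0\<close>, some root \<open>\<alpha>\<close> has \<open>c\<^sub>\<alpha> (v, \<alpha>) > 0\<close>. With \<open>s\<close> the sign of \<open>c\<^sub>\<alpha>\<close>,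
  either \<open>v = s \<alpha>\<close>, or \<open>v - s \<alpha>\<close> is again of norm \<open>2\<close>, has a shorter expression, and is the
  reflection of \<open>v\<close> in \<open>\<alpha>\<close>.\<close>
lemma norm_two_lattice_vector_is_root:
  assumes "v \<in> int_span \<Phi>" "v \<bullet> v = 2"
  shows "v \<in> \<Phi>"
proof -
  have "v \<in> \<Phi>" if "(\<Sum>\<alpha>\<in>\<Phi>. nat \<bar>c \<alpha>\<bar>) = m" "v = (\<Sum>\<alpha>\<in>\<Phi>. int_scale (c \<alpha>) \<alpha>)" "v \<bullet> v = 2"
    for m c v
    using that
  proof (induction m arbitrary: c v rule: less_induct)
    case (less m)
    have "v \<bullet> v = (\<Sum>\<alpha>\<in>\<Phi>. of_int (c \<alpha>) * (v \<bullet> \<alpha>))"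
      by (subst (2) less.prems(2)) (simp add: inner_sum_right)
    then have "\<not> (\<forall>\<alpha>\<in>\<Phi>. of_int (c \<alpha>) * (v \<bullet> \<alpha>) \<le> 0)"
      using less.prems(3) sum_nonpos[of \<Phi> "\<lambda>\<alpha>. of_int (c \<alpha>) * (v \<bullet> \<alpha>)"] by auto
    then obtain \<alpha> where \<alpha>: "\<alpha> \<in> \<Phi>" and pos: "of_int (c \<alpha>) * (v \<bullet> \<alpha>) > 0" by force
    have va: "v \<bullet> \<alpha> \<in> \<int>"
      using root_inner_Ints \<alpha> by (auto simp: less.prems(2) inner_sum_left)
    define s :: int where "s = sgn (c \<alpha>)"
    have s: "s \<in> {-1, 1}" and ca: "c \<alpha> = s * \<bar>c \<alpha>\<bar>" "c \<alpha> \<noteq> 0" and sv: "of_int s * (v \<bullet> \<alpha>) > 0"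
      using pos by (auto simp: s_def sgn_if zero_less_mult_iff)
    let ?u = "v - of_int s *\<^sub>R \<alpha>"
    consider "v = of_int s *\<^sub>R \<alpha>" | "v \<bullet> \<alpha> = of_int s"
      using norm_two_inner_cases[OF less.prems(3) root_norm[OF \<alpha>] va] s sv by auto
    then show ?case
    proof cases
      case 1
      then show ?thesis using \<alpha> uminus_root s by auto
    next
      case 2
      have u2: "?u \<bullet> ?u = 2"
        using 2 less.prems(3) root_norm[OF \<alpha>] s by (auto simp: algebra_simps inner_commute)
      define c' where "c' = c(\<alpha> := c \<alpha> - s)"
      have "?u = (\<Sum>\<beta>\<in>\<Phi>. int_scale (c' \<beta>) \<beta>)"
        using finite_roots \<alpha>
        by (simp add: less.prems(2) c'_def sum.remove[of \<Phi> \<alpha>] algebra_simps)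
      moreover have "nat \<bar>c \<alpha> - s\<bar> < nat \<bar>c \<alpha>\<bar>" using s ca by auto
      then have "(\<Sum>\<beta>\<in>\<Phi>. nat \<bar>c' \<beta>\<bar>) < m"
        using finite_roots \<alpha> less.prems(1) by (auto simp: c'_def sum.remove[of \<Phi> \<alpha>])
      ultimately have u: "?u \<in> \<Phi>" using less.IH u2 by blast
      have "reflection \<alpha> ?u = v"
        using 2 root_norm[OF \<alpha>] by (simp add: reflection_root[OF \<alpha>] algebra_simps)
      then show ?thesis using reflection_roots[OF \<alpha>] u by (metis imageI)
    qed
  qed
  moreover obtain c where "v = (\<Sum>\<alpha>\<in>\<Phi>. int_scale (c \<alpha>) \<alpha>)"
    using assms(1) int_module.span_finite[OF finite_roots] by blast
  ultimately show ?thesis using assms(2) by blast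
qed

lemma lattice_isometry_permutes_roots:
  assumes T: "orthogonal_transformation T" and "T ` int_span \<Phi> = int_span \<Phi>"
  shows "T ` \<Phi> = \<Phi>"
proof -
  have "T ` \<Phi> \<subseteq> \<Phi>"
  proof clarify
    fix \<alpha> assume \<alpha>: "\<alpha> \<in> \<Phi>"
    then have "T \<alpha> \<in> int_span \<Phi>" using assms(2) int_module.span_base by blast
    moreover have "T \<alpha> \<bullet> T \<alpha> = 2" using T \<alpha> root_norm by (simp add: orthogonal_transformation_def)
    ultimately show "T \<alpha> \<in> \<Phi>" by (rule norm_two_lattice_vector_is_root)
  qed
  then show ?thesis
    using orthogonal_transformation_inj[OF T] finite_roots
    by (meson endo_inj_surj inj_on_subset subset_UNIV)
qed

lemma reflection_orthogonal: "\<alpha> \<in> \<Phi> \<Longrightarrow> orthogonal_transformation (reflection \<alpha>)"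
  unfolding orthogonal_transformation_def
  by (auto simp: reflection_root root_norm algebra_simps inner_commute intro!: linearI)

lemma weyl_group_isometry:
  "w \<in> weyl_group \<Phi> \<Longrightarrow> orthogonal_transformation w \<and> w ` \<Phi> = \<Phi>"
proof (induction rule: weyl_group.induct)
  case 1
  then show ?case by (simp add: orthogonal_transformation_id[unfolded id_def[symmetric]])
next
  case (2 \<alpha> w)
  then show ?case
    using reflection_roots orthogonal_transformation_compose[OF reflection_orthogonal]
    by (metis image_comp)
qed

lemma int_span_simple_system:
  assumes "simple_system \<Phi> S"
  shows "int_span S = int_span \<Phi>"
proof
  show "int_span S \<subseteq> int_span \<Phi>"
    using assms by (intro int_module.span_mono) (simp add: simple_system_def)
  have "\<beta> \<in> int_span S" if "\<beta> \<in> \<Phi>" for \<beta>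
  proof -
    obtain c :: "'a \<Rightarrow> nat" where
      "\<beta> = (\<Sum>\<alpha>\<in>S. real (c \<alpha>) *\<^sub>R \<alpha>) \<or> \<beta> = - (\<Sum>\<alpha>\<in>S. real (c \<alpha>) *\<^sub>R \<alpha>)"
      using assms \<open>\<beta> \<in> \<Phi>\<close> unfolding simple_system_def by blast
    moreover have "(\<Sum>\<alpha>\<in>S. int_scale (int (c \<alpha>)) \<alpha>) \<in> int_span S"
      by (intro int_module.span_sum int_module.span_scale int_module.span_base)
    ultimately show ?thesis using int_module.span_neg by fastforce
  qed
  then show "int_span \<Phi> \<subseteq> int_span S"
    by (intro int_module.span_minimal) auto
qed

lemma simple_system_image:
  assumes S: "simple_system \<Phi> S" and T: "orthogonal_transformation T" "T ` \<Phi> = \<Phi>"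
  shows "simple_system \<Phi> (T ` S)"
  unfolding simple_system_def
proof (intro conjI ballI)
  have lin: "linear T" and inj: "inj T"
    using T orthogonal_transformation_linear orthogonal_transformation_inj by blast+
  show "T ` S \<subseteq> \<Phi>" "independent (T ` S)"
    using S T(2) linear_independent_injective_image[OF lin] inj_on_subset[OF inj subset_UNIV]
    unfolding simple_system_def by blast+
  fix \<beta> assume "\<beta> \<in> \<Phi>"
  then obtain \<alpha> where \<alpha>: "\<alpha> \<in> \<Phi>" "\<beta> = T \<alpha>" using T by blast
  then obtain c :: "'a \<Rightarrow> nat" where
    c: "\<alpha> = (\<Sum>\<alpha>\<in>S. real (c \<alpha>) *\<^sub>R \<alpha>) \<or> \<alpha> = - (\<Sum>\<alpha>\<in>S. real (c \<alpha>) *\<^sub>R \<alpha>)"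
    using S unfolding simple_system_def by blast
  have "T (\<Sum>\<alpha>\<in>S. real (c \<alpha>) *\<^sub>R \<alpha>) = (\<Sum>\<alpha>\<in>T ` S. real (c (inv T \<alpha>)) *\<^sub>R \<alpha>)"
    using inj by (simp add: linear_sum[OF lin] linear_scale[OF lin] sum.reindex inj_on_subset[OF inj])
  then show "\<exists>c :: 'a \<Rightarrow> nat. \<beta> = (\<Sum>\<alpha>\<in>T ` S. real (c \<alpha>) *\<^sub>R \<alpha>) \<or>
      \<beta> = - (\<Sum>\<alpha>\<in>T ` S. real (c \<alpha>) *\<^sub>R \<alpha>)"
    using c \<alpha>(2) linear_neg[OF lin] by (intro exI[of _ "\<lambda>\<alpha>. c (inv T \<alpha>)"]) auto
qed

lemma simple_system_card:
  assumes "simple_system \<Phi> S"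
  shows "finite S" "card S = DIM('a)" "span S = UNIV"
proof -
  show "finite S" using assms finite_roots finite_subset by (auto simp: simple_system_def)
  show sp: "span S = UNIV"
    by (metis assms int_span_simple_system span_int_span span_roots)
  then show "card S = DIM('a)"
    using assms dim_eq_card[of S UNIV] by (simp add: simple_system_def)
qed

text \<open>Pairing with \<open>\<delta>\<close> computes heights with respect to \<open>S\<close>; in particular it tells positive roots
  from negative ones.\<close>
lemma simple_system_height_vector:
  assumes "simple_system \<Phi> S"
  shows "\<exists>\<delta>. \<forall>\<alpha>\<in>S. \<delta> \<bullet> \<alpha> = 1"
proof -
  obtain f :: "'a \<Rightarrow> real" where f: "linear f" "\<forall>\<alpha>\<in>S. f \<alpha> = 1"
    using assms linear_independent_extend[of S "\<lambda>_. 1"] by (auto simp: simple_system_def)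
  have "adjoint f 1 \<bullet> \<alpha> = f \<alpha>" for \<alpha>
    using adjoint_works[OF f(1), of \<alpha> 1] by (simp add: inner_commute)
  then have "\<forall>\<alpha>\<in>S. adjoint f 1 \<bullet> \<alpha> = 1" using f(2) by simp
  then show ?thesis by blast
qed

lemma root_height_nonzero_int:
  assumes S: "simple_system \<Phi> S" and \<delta>: "\<forall>\<alpha>\<in>S. \<delta> \<bullet> \<alpha> = 1" and "\<beta> \<in> \<Phi>"
  shows "\<delta> \<bullet> \<beta> \<in> \<int>" "\<delta> \<bullet> \<beta> \<noteq> 0"
proof -
  obtain c :: "'a \<Rightarrow> nat" where
    c: "\<beta> = (\<Sum>\<alpha>\<in>S. real (c \<alpha>) *\<^sub>R \<alpha>) \<or> \<beta> = - (\<Sum>\<alpha>\<in>S. real (c \<alpha>) *\<^sub>R \<alpha>)"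
    using S \<open>\<beta> \<in> \<Phi>\<close> unfolding simple_system_def by blast
  have h: "\<delta> \<bullet> (\<Sum>\<alpha>\<in>S. real (c \<alpha>) *\<^sub>R \<alpha>) = real (\<Sum>\<alpha>\<in>S. c \<alpha>)"
    using \<delta> by (simp add: inner_sum_right)
  have "\<delta> \<bullet> \<beta> = real (\<Sum>\<alpha>\<in>S. c \<alpha>) \<or> \<delta> \<bullet> \<beta> = - real (\<Sum>\<alpha>\<in>S. c \<alpha>)"
    using c h by (elim disjE) simp_all
  then show "\<delta> \<bullet> \<beta> \<in> \<int>"
    by (elim disjE) (simp_all only: Ints_of_nat Ints_minus)
  show "\<delta> \<bullet> \<beta> \<noteq> 0"
  proof
    assume "\<delta> \<bullet> \<beta> = 0"
    then have "real (\<Sum>\<alpha>\<in>S. c \<alpha>) = 0" using c h by auto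
    then have "(\<Sum>\<alpha>\<in>S. c \<alpha>) = 0" by (simp only: of_nat_eq_0_iff)
    then have "\<forall>\<alpha>\<in>S. c \<alpha> = 0" using simple_system_card(1)[OF S] by simp
    then have "\<beta> = 0" using c by auto
    then show False using root_norm[OF \<open>\<beta> \<in> \<Phi>\<close>] by simp
  qed
qed

text \<open>If all of \<open>S'\<close> is positive for \<open>S\<close>, then each \<open>\<alpha> \<in> S\<close> is a nonnegative combination of \<open>S'\<close>.
  Elements of \<open>S'\<close> have height at least \<open>1\<close> and \<open>\<alpha>\<close> has height \<open>1\<close>, so this combination has a
  single term. Thus \<open>S \<subseteq> S'\<close>, and both have as many elements as the dimension.\<close>
lemma simple_system_eq_if_positive:
  assumes S: "simple_system \<Phi> S" and \<delta>: "\<forall>\<alpha>\<in>S. \<delta> \<bullet> \<alpha> = 1"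
    and S': "simple_system \<Phi> S'" and pos: "\<And>\<beta>. \<beta> \<in> S' \<Longrightarrow> 0 \<le> \<delta> \<bullet> \<beta>"
  shows "S = S'"
proof -
  have fin': "finite S'" using simple_system_card(1)[OF S'] .
  have ge1: "1 \<le> \<delta> \<bullet> \<beta>" if "\<beta> \<in> S'" for \<beta>
  proof -
    have "\<beta> \<in> \<Phi>" using that S' by (auto simp: simple_system_def)
    then obtain k where "\<delta> \<bullet> \<beta> = of_int k" "k \<noteq> 0"
      using root_height_nonzero_int[OF S \<delta>, of \<beta>] by (auto elim: Ints_cases)
    then show ?thesis using pos[OF that] by auto
  qed
  have "S \<subseteq> S'"
  proof
    fix \<alpha> assume \<alpha>: "\<alpha> \<in> S"
    then have "\<alpha> \<in> \<Phi>" using S by (auto simp: simple_system_def)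
    then obtain c :: "'a \<Rightarrow> nat" where
      c: "\<alpha> = (\<Sum>\<beta>\<in>S'. real (c \<beta>) *\<^sub>R \<beta>) \<or> \<alpha> = - (\<Sum>\<beta>\<in>S'. real (c \<beta>) *\<^sub>R \<beta>)"
      using S' unfolding simple_system_def by blast
    have h: "\<delta> \<bullet> (\<Sum>\<beta>\<in>S'. real (c \<beta>) *\<^sub>R \<beta>) = (\<Sum>\<beta>\<in>S'. real (c \<beta>) * (\<delta> \<bullet> \<beta>))"
      by (simp add: inner_sum_right)
    have ge: "real (\<Sum>\<beta>\<in>S'. c \<beta>) \<le> (\<Sum>\<beta>\<in>S'. real (c \<beta>) * (\<delta> \<bullet> \<beta>))"
      unfolding of_nat_sum
      by (intro sum_mono) (use ge1 mult_left_mono[of 1] in force)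
    have "\<alpha> \<noteq> - (\<Sum>\<beta>\<in>S'. real (c \<beta>) *\<^sub>R \<beta>)"
    proof
      assume "\<alpha> = - (\<Sum>\<beta>\<in>S'. real (c \<beta>) *\<^sub>R \<beta>)"
      then have "\<delta> \<bullet> \<alpha> = - (\<Sum>\<beta>\<in>S'. real (c \<beta>) * (\<delta> \<bullet> \<beta>))" using h by simp
      then have "1 \<le> - real (\<Sum>\<beta>\<in>S'. c \<beta>)" using ge \<delta> \<alpha> by auto
      then show False using of_nat_0_le_iff[of "\<Sum>\<beta>\<in>S'. c \<beta>", where 'a = real] by linarith
    qed
    then have a: "\<alpha> = (\<Sum>\<beta>\<in>S'. real (c \<beta>) *\<^sub>R \<beta>)" using c by blast
    then have "real (\<Sum>\<beta>\<in>S'. c \<beta>) \<le> 1" using h ge \<delta> \<alpha> by auto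
    then have le: "(\<Sum>\<beta>\<in>S'. c \<beta>) \<le> 1" by linarith
    have "\<alpha> \<noteq> 0" using root_norm[OF \<open>\<alpha> \<in> \<Phi>\<close>] by auto
    have "\<not> (\<forall>\<beta>\<in>S'. c \<beta> = 0)"
    proof
      assume "\<forall>\<beta>\<in>S'. c \<beta> = 0"
      then have "(\<Sum>\<beta>\<in>S'. real (c \<beta>) *\<^sub>R \<beta>) = 0" by simp
      then show False using a \<open>\<alpha> \<noteq> 0\<close> by simp
    qed
    then obtain \<beta> where \<beta>: "\<beta> \<in> S'" "c \<beta> \<noteq> 0" by blast
    have "c \<beta> + (\<Sum>\<beta>\<in>S' - {\<beta>}. c \<beta>) \<le> 1" using le by (simp add: sum.remove[OF fin' \<beta>(1)])
    then have "c \<beta> = 1" "(\<Sum>\<beta>\<in>S' - {\<beta>}. c \<beta>) = 0" using \<beta>(2) by auto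
    then have "c \<beta> = 1" "\<forall>\<beta>'\<in>S' - {\<beta>}. c \<beta>' = 0" using fin' by auto
    then have "\<alpha> = \<beta>" using a by (simp add: sum.remove[OF fin' \<beta>(1)])
    then show "\<alpha> \<in> S'" using \<beta>(1) by simp
  qed
  then show ?thesis
    using card_subset_eq[OF fin'] simple_system_card(2)[OF S] simple_system_card(2)[OF S'] by simp
qed

text \<open>The image \<open>w v\<close> is determined by the permutation that \<open>w\<close> induces on the finite spanning set of
  roots.\<close>
lemma finite_weyl_orbit: "finite {w v |w. w \<in> weyl_group \<Phi>}"
proof -
  have "v \<in> range (\<lambda>c. \<Sum>\<alpha>\<in>\<Phi>. c \<alpha> *\<^sub>R \<alpha>)"
    using span_roots by (simp add: span_finite[OF finite_roots])
  then obtain c where c: "v = (\<Sum>\<alpha>\<in>\<Phi>. c \<alpha> *\<^sub>R \<alpha>)" by blast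
  have "w v \<in> (\<lambda>g. \<Sum>\<alpha>\<in>\<Phi>. c \<alpha> *\<^sub>R g \<alpha>) ` (\<Phi> \<rightarrow>\<^sub>E \<Phi>)" if "w \<in> weyl_group \<Phi>" for w
  proof
    have lin: "linear w" and w: "w ` \<Phi> = \<Phi>"
      using weyl_group_isometry[OF that] orthogonal_transformation_linear by blast+
    show "w v = (\<Sum>\<alpha>\<in>\<Phi>. c \<alpha> *\<^sub>R restrict w \<Phi> \<alpha>)"
      by (simp add: c linear_sum[OF lin] linear_scale[OF lin])
    show "restrict w \<Phi> \<in> \<Phi> \<rightarrow>\<^sub>E \<Phi>" using w by auto
  qed
  then have "{w v |w. w \<in> weyl_group \<Phi>} \<subseteq> (\<lambda>g. \<Sum>\<alpha>\<in>\<Phi>. c \<alpha> *\<^sub>R g \<alpha>) ` (\<Phi> \<rightarrow>\<^sub>E \<Phi>)" by blast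
  then show ?thesis by (rule finite_subset) (intro finite_imageI finite_PiE finite_roots)
qed

text \<open>Choose \<open>w\<close> such that the height vector \<open>w \<delta>\<close> of \<open>w S\<close> has the largest possible inner product with
  the height vector \<open>\<delta>'\<close> of \<open>S'\<close>. Reflecting in \<open>\<beta> \<in> S'\<close> changes it by \<open>- (w \<delta>, \<beta>)\<close>, so
  \<open>(w \<delta>, \<beta>) \<ge> 0\<close> for all \<open>\<beta> \<in> S'\<close>, that is, \<open>S'\<close> is positive for \<open>w S\<close>.\<close>
lemma simple_systems_conjugate:
  assumes S: "simple_system \<Phi> S" and S': "simple_system \<Phi> S'"
  shows "\<exists>w\<in>weyl_group \<Phi>. w ` S = S'"
proof -
  obtain \<delta> \<delta>' where \<delta>: "\<forall>\<alpha>\<in>S. \<delta> \<bullet> \<alpha> = 1" and \<delta>': "\<forall>\<alpha>\<in>S'. \<delta>' \<bullet> \<alpha> = 1"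
    using simple_system_height_vector S S' by blast
  let ?O = "{w \<delta> |w. w \<in> weyl_group \<Phi>}"
  have "finite ((\<lambda>u. u \<bullet> \<delta>') ` ?O)" "(\<lambda>u. u \<bullet> \<delta>') ` ?O \<noteq> {}"
    using finite_weyl_orbit weyl_group.intros(1) by auto
  then have "Max ((\<lambda>u. u \<bullet> \<delta>') ` ?O) \<in> (\<lambda>u. u \<bullet> \<delta>') ` ?O"
    and ub: "\<And>u. u \<in> ?O \<Longrightarrow> u \<bullet> \<delta>' \<le> Max ((\<lambda>u. u \<bullet> \<delta>') ` ?O)"
    by (auto intro!: Max_in Max_ge)
  then obtain w where w: "w \<in> weyl_group \<Phi>"
    and max: "\<And>u. u \<in> ?O \<Longrightarrow> u \<bullet> \<delta>' \<le> w \<delta> \<bullet> \<delta>'" by auto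
  note wi = weyl_group_isometry[OF w]
  have "w ` S = S'"
  proof (rule simple_system_eq_if_positive)
    show "simple_system \<Phi> (w ` S)" using simple_system_image S wi by blast
    show "\<forall>\<alpha>\<in>w ` S. w \<delta> \<bullet> \<alpha> = 1" using wi \<delta> by (auto simp: orthogonal_transformation_def)
    fix \<beta> assume \<beta>: "\<beta> \<in> S'"
    then have r: "\<beta> \<in> \<Phi>" using S' by (auto simp: simple_system_def)
    have "reflection \<beta> (w \<delta>) \<in> ?O"
      using weyl_group.intros(2)[OF r w] by (intro CollectI exI[of _ "reflection \<beta> \<circ> w"]) simp
    then have "reflection \<beta> (w \<delta>) \<bullet> \<delta>' \<le> w \<delta> \<bullet> \<delta>'" by (rule max)
    moreover have "\<beta> \<bullet> \<delta>' = 1" using \<delta>' \<beta> by (simp add: inner_commute)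
    ultimately show "0 \<le> w \<delta> \<bullet> \<beta>" by (simp add: reflection_root[OF r] inner_diff_left)
  qed (rule S')
  then show ?thesis using w by blast
qed

end


section \<open>Companion bases as integral frames\<close>

lemma independent_range_iff:
  fixes g :: "'n::finite \<Rightarrow> 'a::real_vector"
  assumes "inj g"
  shows "independent (range g) \<longleftrightarrow> (\<forall>v :: real ^ 'n. (\<Sum>x\<in>UNIV. v $ x *\<^sub>R g x) = 0 \<longrightarrow> v = 0)"
proof -
  have reindex: "(\<Sum>v\<in>range g. u v *\<^sub>R v) = (\<Sum>x\<in>UNIV. u (g x) *\<^sub>R g x)" for u
    using assms by (simp add: sum.reindex)
  show ?thesis
  proof (intro iffI allI impI)
    fix v :: "real ^ 'n"
    assume ind: "independent (range g)" and zero: "(\<Sum>x\<in>UNIV. v $ x *\<^sub>R g x) = 0"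
    have "(\<Sum>u\<in>range g. (v $ inv g u) *\<^sub>R u) = 0" using zero assms by (simp add: reindex)
    then have "v $ inv g u = 0" if "u \<in> range g" for u
      using ind that dependent_finite[of "range g"] by auto
    then show "v = 0" using assms by (force simp: vec_eq_iff)
  next
    assume *: "\<forall>v :: real ^ 'n. (\<Sum>x\<in>UNIV. v $ x *\<^sub>R g x) = 0 \<longrightarrow> v = 0"
    show "independent (range g)"
    proof
      assume "dependent (range g)"
      then obtain u x where u: "(\<Sum>v\<in>range g. u v *\<^sub>R v) = 0" "u (g x) \<noteq> 0"
        using dependent_finite[of "range g"] by auto
      then have "(\<chi> x. u (g x)) = 0" using * by (simp add: reindex)
      then show False using u(2) by (simp add: vec_eq_iff)
    qed
  qed
qed

lemma gram_matrix_quadratic_form: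
  fixes g :: "'n::finite \<Rightarrow> 'a::real_inner"
  shows "v \<bullet> ((\<chi> x y. g x \<bullet> g y) *v v) = (\<Sum>x\<in>UNIV. v $ x *\<^sub>R g x) \<bullet> (\<Sum>x\<in>UNIV. v $ x *\<^sub>R g x)"
  by (simp add: inner_vec_def matrix_vector_mult_def inner_sum_left inner_sum_right
      sum_distrib_left mult_ac) (subst sum.swap, simp add: inner_commute mult_ac)

lemma independent_imp_int_independent:
  assumes "independent X"
  shows "module.independent int_scale X"
proof
  assume "int_module.dependent X"
  then obtain t c v where "finite t" "t \<subseteq> X" "(\<Sum>v\<in>t. int_scale (c v) v) = 0" "v \<in> t" "c v \<noteq> 0"
    unfolding int_module.dependent_explicit by blast
  then have "dependent X"
    unfolding dependent_explicit by (intro exI[of _ t] exI[of _ "\<lambda>v. of_int (c v)"]) auto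
  then show False using assms by simp
qed

text \<open>Positivity of the Gram matrix and linear independence over \<open>\<real>\<close> say the same, and the latter
  implies linear independence over \<open>\<int>\<close>. So a companion basis is a frame of roots spanning the root
  lattice whose inner products have the prescribed absolute values.\<close>
lemma companion_basis_iff:
  assumes \<Phi>: "norm_two_root_system \<Phi>"
  shows "companion_basis \<Phi> B \<gamma> \<longleftrightarrow> range \<gamma> \<subseteq> \<Phi> \<and> norm_two_frame \<gamma> \<and>
    int_span (range \<gamma>) = int_span \<Phi> \<and> (\<forall>x y. x \<noteq> y \<longrightarrow> \<bar>\<gamma> x \<bullet> \<gamma> y\<bar> = real_of_int \<bar>B $ x $ y\<bar>)"
proof (intro iffI conjI)
  assume "companion_basis \<Phi> B \<gamma>"
  then obtain A where roots: "range \<gamma> \<subseteq> \<Phi>" and basis: "is_int_basis \<gamma> (int_span \<Phi>)"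
    and A: "\<And>x y. of_int (A $ x $ y) = \<gamma> x \<bullet> \<gamma> y"
    and comp: "quasi_cartan_companion B A" and pos: "positive_definite A"
    by (auto simp: companion_basis_def)
  show "range \<gamma> \<subseteq> \<Phi>" "int_span (range \<gamma>) = int_span \<Phi>"
    using roots basis by (auto simp: is_int_basis_def)
  have inj: "inj \<gamma>" using basis by (simp add: is_int_basis_def)
  have "v = 0" if "(\<Sum>x\<in>UNIV. v $ x *\<^sub>R \<gamma> x) = 0" for v :: "real ^ 'b"
    using pos gram_matrix_quadratic_form[of v \<gamma>] that unfolding positive_definite_def A
    by (metis inner_zero_left less_irrefl)
  then have "independent (range \<gamma>)" using independent_range_iff[OF inj] by blast
  then show "norm_two_frame \<gamma>"
    using inj roots root_norm[OF \<Phi>] root_inner_Ints[OF \<Phi>]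
    by (simp add: norm_two_frame_def image_subset_iff)
  show "\<forall>x y. x \<noteq> y \<longrightarrow> \<bar>\<gamma> x \<bullet> \<gamma> y\<bar> = real_of_int \<bar>B $ x $ y\<bar>"
  proof (intro allI impI)
    fix x y :: 'b assume "x \<noteq> y"
    then have "\<bar>A $ x $ y\<bar> = \<bar>B $ x $ y\<bar>" using comp by (simp add: quasi_cartan_companion_def)
    then show "\<bar>\<gamma> x \<bullet> \<gamma> y\<bar> = real_of_int \<bar>B $ x $ y\<bar>" by (metis A of_int_abs)
  qed
next
  assume R: "range \<gamma> \<subseteq> \<Phi> \<and> norm_two_frame \<gamma> \<and> int_span (range \<gamma>) = int_span \<Phi> \<and>
    (\<forall>x y. x \<noteq> y \<longrightarrow> \<bar>\<gamma> x \<bullet> \<gamma> y\<bar> = real_of_int \<bar>B $ x $ y\<bar>)"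
  then have inj: "inj \<gamma>" and ind: "independent (range \<gamma>)" and norm: "\<And>x. \<gamma> x \<bullet> \<gamma> x = 2"
    and int: "\<And>x y. \<gamma> x \<bullet> \<gamma> y \<in> \<int>"
    and abs: "\<And>x y. x \<noteq> y \<Longrightarrow> \<bar>\<gamma> x \<bullet> \<gamma> y\<bar> = real_of_int \<bar>B $ x $ y\<bar>"
    by (auto simp: norm_two_frame_def)
  define A :: "int ^ 'b ^ 'b" where "A = (\<chi> x y. \<lfloor>\<gamma> x \<bullet> \<gamma> y\<rfloor>)"
  have A: "real_of_int (A $ x $ y) = \<gamma> x \<bullet> \<gamma> y" for x y
    using int[of x y] by (simp add: A_def of_int_floor)
  have "quasi_cartan_companion B A"
    unfolding quasi_cartan_companion_def
  proof (intro conjI allI impI)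
    show "transpose A = A" by (simp add: A_def transpose_def inner_commute)
    show "A $ x $ x = 2" for x by (simp add: A_def norm)
    fix x y :: 'b assume "x \<noteq> y"
    then have "real_of_int \<bar>A $ x $ y\<bar> = real_of_int \<bar>B $ x $ y\<bar>" using abs A by simp
    then show "\<bar>A $ x $ y\<bar> = \<bar>B $ x $ y\<bar>" by linarith
  qed
  moreover have "positive_definite A"
    unfolding positive_definite_def A gram_matrix_quadratic_form
    using ind independent_range_iff[OF inj] by (auto simp: inner_gt_zero_iff)
  moreover have "is_int_basis \<gamma> (int_span \<Phi>)"
    using R inj independent_imp_int_independent[OF ind] by (simp add: is_int_basis_def)
  ultimately show "companion_basis \<Phi> B \<gamma>"
    unfolding companion_basis_def by (intro conjI exI[of _ A] allI A) (simp_all add: R)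
qed

lemma int_span_sign_change:
  fixes \<epsilon> :: "'n \<Rightarrow> real"
  assumes "\<And>x. \<epsilon> x \<in> {1, -1}"
  shows "int_span (range (\<lambda>x. \<epsilon> x *\<^sub>R g x)) = int_span (range g)"
proof -
  have sub: "int_span (range (\<lambda>x. \<epsilon> x *\<^sub>R h x)) \<subseteq> int_span (range h)" for h :: "'n \<Rightarrow> 'a"
  proof (intro int_module.span_minimal image_subsetI)
    fix x
    have "h x \<in> int_span (range h)" by (intro int_module.span_base) auto
    then show "\<epsilon> x *\<^sub>R h x \<in> int_span (range h)"
      using assms[of x] int_module.span_neg by fastforce
  qed simp
  have twice: "(\<lambda>x. \<epsilon> x *\<^sub>R \<epsilon> x *\<^sub>R g x) = g"
  proof
    show "\<epsilon> x *\<^sub>R \<epsilon> x *\<^sub>R g x = g x" for x using assms[of x] by auto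
  qed
  show ?thesis
    using sub[of g] sub[of "\<lambda>x. \<epsilon> x *\<^sub>R g x", unfolded twice] by (rule subset_antisym)
qed

lemma orthogonal_transformation_if_gram_eq:
  fixes T :: "'a::euclidean_space \<Rightarrow> 'a" and g :: "'n \<Rightarrow> 'a"
  assumes "linear T" and "span (range g) = UNIV" and "\<And>x y. T (g x) \<bullet> T (g y) = g x \<bullet> g y"
  shows "orthogonal_transformation T"
proof -
  have "bilinear (\<lambda>v w. T v \<bullet> T w)" "bilinear (\<lambda>v w :: 'a. v \<bullet> w)"
    using assms(1) by (auto simp: bilinear_def linear_iff inner_add_left inner_add_right)
  moreover have "T v \<bullet> T w = v \<bullet> w" if "v \<in> range g" "w \<in> range g" for v w
    using that assms(3) by auto
  ultimately have "T v \<bullet> T w = v \<bullet> w" for v w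
    using bilinear_eq[of "\<lambda>v w. T v \<bullet> T w" "\<lambda>v w. v \<bullet> w" UNIV "range g" UNIV "range g" v w]
      assms(2) by simp
  then show ?thesis using assms(1) by (simp add: orthogonal_transformation_def)
qed

lemma norm_two_frame_orthogonal_image:
  assumes "norm_two_frame g" and T: "orthogonal_transformation T"
  shows "norm_two_frame (\<lambda>x. T (g x))"
proof -
  have lin: "linear T" and inj: "inj T"
    using T orthogonal_transformation_linear orthogonal_transformation_inj by blast+
  have "independent (T ` range g)"
    using assms(1) linear_independent_injective_image[OF lin] inj_on_subset[OF inj subset_UNIV]
    unfolding norm_two_frame_def by blast
  moreover have "inj (\<lambda>x. T (g x))"
    using assms(1) inj by (simp add: norm_two_frame_def inj_def)
  ultimately show ?thesis
    using assms by (simp add: norm_two_frame_def image_image orthogonal_transformation_def)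
qed

lemma companion_basis_image:
  assumes \<Phi>: "norm_two_root_system \<Phi>" and \<gamma>: "companion_basis \<Phi> B \<gamma>"
    and T: "orthogonal_transformation T" "T ` \<Phi> = \<Phi>" and \<epsilon>: "\<And>x. \<epsilon> x \<in> {1, -1}"
  shows "companion_basis \<Phi> B (\<lambda>x. \<epsilon> x *\<^sub>R T (\<gamma> x))"
proof -
  note \<gamma>' = \<gamma>[unfolded companion_basis_iff[OF \<Phi>]]
  have lin: "linear T" using T(1) orthogonal_transformation_linear by blast
  have "\<gamma> x \<in> \<Phi>" for x using \<gamma>' by (simp add: image_subset_iff)
  then have "T (\<gamma> x) \<in> \<Phi>" for x using T(2) imageI by metis
  then have "\<epsilon> x *\<^sub>R T (\<gamma> x) \<in> \<Phi>" for x using \<epsilon>[of x] uminus_root[OF \<Phi>] by auto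
  moreover have "norm_two_frame (\<lambda>x. \<epsilon> x *\<^sub>R T (\<gamma> x))"
  proof (rule norm_two_frame_sign_change[of "\<lambda>x. T (\<gamma> x)" \<epsilon>])
    show "norm_two_frame (\<lambda>x. T (\<gamma> x))"
      using \<gamma>' norm_two_frame_orthogonal_image[OF _ T(1), of \<gamma>] by simp
  qed (rule \<epsilon>)
  moreover have "int_span (range (\<lambda>x. \<epsilon> x *\<^sub>R T (\<gamma> x))) = int_span \<Phi>"
  proof -
    have "int_span (range (\<lambda>x. \<epsilon> x *\<^sub>R T (\<gamma> x))) = int_span (T ` range \<gamma>)"
      using int_span_sign_change[of \<epsilon> "\<lambda>x. T (\<gamma> x)"] \<epsilon> by (simp add: image_image)
    also have "\<dots> = int_span (T ` \<Phi>)" using \<gamma>' by (simp add: int_span_linear_image[OF lin])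
    finally show ?thesis by (simp add: T(2))
  qed
  moreover have "\<bar>(\<epsilon> x *\<^sub>R T (\<gamma> x)) \<bullet> (\<epsilon> y *\<^sub>R T (\<gamma> y))\<bar> = \<bar>\<gamma> x \<bullet> \<gamma> y\<bar>" for x y
    using T(1) \<epsilon>[of x] \<epsilon>[of y] by (auto simp: orthogonal_transformation_def)
  ultimately show ?thesis using \<gamma>' unfolding companion_basis_iff[OF \<Phi>] by auto
qed


section \<open>Companion bases up to isometries and signs\<close>

text \<open>Equality of the Gram matrices up to the signs \<open>\<epsilon>\<close> makes \<open>\<gamma>\<^sub>x \<mapsto> \<epsilon>\<^sub>x \<gamma>'\<^sub>x\<close> an isometry; it preserves the
  root lattice because both families generate it.\<close>
lemma companion_bases_isometric:
  assumes \<Phi>: "norm_two_root_system \<Phi>" and \<gamma>: "companion_basis \<Phi> B \<gamma>"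
    and \<gamma>': "companion_basis \<Phi> B \<gamma>'"
  shows "\<exists>T \<epsilon>. orthogonal_transformation T \<and> T ` \<Phi> = \<Phi> \<and> (\<forall>x. \<epsilon> x \<in> {1, -1}) \<and>
    \<gamma>' = (\<lambda>x. \<epsilon> x *\<^sub>R T (\<gamma> x))"
proof -
  note g = \<gamma>[unfolded companion_basis_iff[OF \<Phi>]] and h = \<gamma>'[unfolded companion_basis_iff[OF \<Phi>]]
  have frames: "norm_two_frame \<gamma>" "norm_two_frame \<gamma>'" using g h by simp_all
  have abs: "\<bar>\<gamma>' x \<bullet> \<gamma>' y\<bar> = \<bar>\<gamma> x \<bullet> \<gamma> y\<bar>" for x y
    using g h by (cases "x = y") (auto simp: norm_two_frame_def)
  obtain \<epsilon> :: "'b \<Rightarrow> real" where \<epsilon>: "\<And>x. \<epsilon> x \<in> {1, -1}"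
    and gram: "\<And>x y. \<epsilon> x * \<epsilon> y * (\<gamma>' x \<bullet> \<gamma>' y) = \<gamma> x \<bullet> \<gamma> y"
    using gram_sign_equivalent_on[OF frames abs, of UNIV] by auto
  have ind: "independent (range \<gamma>)" and inj: "inj \<gamma>" using g by (auto simp: norm_two_frame_def)
  obtain T where lin: "linear T" and "\<forall>u\<in>range \<gamma>. T u = \<epsilon> (inv \<gamma> u) *\<^sub>R \<gamma>' (inv \<gamma> u)"
    using linear_independent_extend[OF ind, of "\<lambda>u. \<epsilon> (inv \<gamma> u) *\<^sub>R \<gamma>' (inv \<gamma> u)"] by blast
  then have T: "T (\<gamma> x) = \<epsilon> x *\<^sub>R \<gamma>' x" for x using inj by simp
  have "span (range \<gamma>) = UNIV" 
    using g span_int_span[of "range \<gamma>"] span_int_span[of \<Phi>] span_roots[OF \<Phi>] by simp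
  then have orth: "orthogonal_transformation T"
    by (rule orthogonal_transformation_if_gram_eq[OF lin]) (simp add: T mult_ac flip: gram)
  have "T ` int_span \<Phi> = T ` int_span (range \<gamma>)" using g by simp
  also have "\<dots> = int_span (range (\<lambda>x. \<epsilon> x *\<^sub>R \<gamma>' x))"
    by (simp add: int_span_linear_image[OF lin, symmetric] image_image T)
  also have "\<dots> = int_span \<Phi>" using h int_span_sign_change[of \<epsilon> \<gamma>'] \<epsilon> by auto
  finally have "T ` \<Phi> = \<Phi>" by (rule lattice_isometry_permutes_roots[OF \<Phi> orth])
  moreover have "\<gamma>' x = \<epsilon> x *\<^sub>R T (\<gamma> x)" for x using \<epsilon>[of x] by (auto simp: T)
  ultimately show ?thesis using orth \<epsilon> by blast
qed

theorem corollary4p11: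
  fixes \<Delta> :: dynkin_type
    and B :: "int ^ 'n ^ 'n"
    and \<Phi> S :: "'a::euclidean_space set"
    and \<gamma> :: "'n \<Rightarrow> 'a"
  assumes "valid_dynkin \<Delta>"
    and "exchange_matrix_of_type \<Delta> B"
    and "root_system_of_type \<Delta> \<Phi>"
    and "\<And>\<alpha>. \<alpha> \<in> \<Phi> \<Longrightarrow> \<alpha> \<bullet> \<alpha> = 2"
    and "simple_system \<Phi> S"
    and "companion_basis \<Phi> B \<gamma>"
  shows "{\<gamma>'. companion_basis \<Phi> B \<gamma>'} =
    {\<lambda>x. \<epsilon> x *\<^sub>R w (\<sigma> (\<gamma> x)) | (\<epsilon> :: 'n \<Rightarrow> real) w \<sigma>.
       (\<forall>x. \<epsilon> x \<in> {1, -1}) \<and> w \<in> weyl_group \<Phi> \<and>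
       orthogonal_transformation \<sigma> \<and> bij_betw \<sigma> S S}"
proof -
  have \<Phi>: "norm_two_root_system \<Phi>"
    using assms(3,4) by (simp add: norm_two_root_system_def root_system_of_type_def)
  note S = assms(5) and \<gamma> = assms(6)
  show ?thesis
  proof (intro subset_antisym subsetI)
    fix \<gamma>' assume "\<gamma>' \<in> {\<gamma>'. companion_basis \<Phi> B \<gamma>'}"
    then obtain T \<epsilon> where T: "orthogonal_transformation T" "T ` \<Phi> = \<Phi>"
      and \<epsilon>: "\<forall>x. \<epsilon> x \<in> {1, -1}" and \<gamma>': "\<gamma>' = (\<lambda>x. \<epsilon> x *\<^sub>R T (\<gamma> x))"
      using companion_bases_isometric[OF \<Phi> \<gamma>] by blast
    obtain w where w: "w \<in> weyl_group \<Phi>" and wS: "w ` S = T ` S"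
      using simple_systems_conjugate[OF \<Phi> S simple_system_image[OF \<Phi> S T]] by blast
    have worth: "orthogonal_transformation w" using weyl_group_isometry[OF \<Phi> w] by blast
    have bij: "bij w" using worth orthogonal_transformation_bij by blast
    define \<sigma> where "\<sigma> = inv w \<circ> T"
    have \<sigma>: "orthogonal_transformation \<sigma>"
      unfolding \<sigma>_def
      by (intro orthogonal_transformation_compose orthogonal_transformation_inv worth T(1))
    have "\<sigma> ` S = inv w ` w ` S" by (simp add: \<sigma>_def wS image_comp)
    then have "\<sigma> ` S = S" using bij by (simp add: image_inv_f_f bij_is_inj)
    then have "bij_betw \<sigma> S S"
      using inj_on_subset[OF orthogonal_transformation_inj[OF \<sigma>] subset_UNIV]
      by (simp add: bij_betw_def)
    moreover have "w (\<sigma> (\<gamma> x)) = T (\<gamma> x)" for x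
      using bij by (simp add: \<sigma>_def surj_f_inv_f bij_is_surj)
    ultimately show "\<gamma>' \<in> {\<lambda>x. \<epsilon> x *\<^sub>R w (\<sigma> (\<gamma> x)) | (\<epsilon> :: 'n \<Rightarrow> real) w \<sigma>.
       (\<forall>x. \<epsilon> x \<in> {1, -1}) \<and> w \<in> weyl_group \<Phi> \<and>
       orthogonal_transformation \<sigma> \<and> bij_betw \<sigma> S S}"
      using \<epsilon> w \<sigma> unfolding \<gamma>' by (intro CollectI exI[of _ \<epsilon>] exI[of _ w] exI[of _ \<sigma>]) simp
  next
    fix \<gamma>' assume "\<gamma>' \<in> {\<lambda>x. \<epsilon> x *\<^sub>R w (\<sigma> (\<gamma> x)) | (\<epsilon> :: 'n \<Rightarrow> real) w \<sigma>.
       (\<forall>x. \<epsilon> x \<in> {1, -1}) \<and> w \<in> weyl_group \<Phi> \<and>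
       orthogonal_transformation \<sigma> \<and> bij_betw \<sigma> S S}"
    then obtain \<epsilon> w \<sigma> where \<epsilon>: "\<And>x. \<epsilon> x \<in> {1, -1}" and w: "w \<in> weyl_group \<Phi>"
      and \<sigma>: "orthogonal_transformation \<sigma>" "\<sigma> ` S = S"
      and \<gamma>': "\<gamma>' = (\<lambda>x. \<epsilon> x *\<^sub>R w (\<sigma> (\<gamma> x)))"
      by (auto simp: bij_betw_def)
    have "\<sigma> ` int_span \<Phi> = int_span \<Phi>"
      using int_span_linear_image[OF orthogonal_transformation_linear[OF \<sigma>(1)], of S] \<sigma>(2)
      by (simp add: int_span_simple_system[OF \<Phi> S])
    then have "\<sigma> ` \<Phi> = \<Phi>" by (rule lattice_isometry_permutes_roots[OF \<Phi> \<sigma>(1)])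
    moreover have w': "orthogonal_transformation w" "w ` \<Phi> = \<Phi>"
      using weyl_group_isometry[OF \<Phi> w] by blast+
    ultimately have image: "(w \<circ> \<sigma>) ` \<Phi> = \<Phi>" by (simp only: image_comp[symmetric])
    have orth: "orthogonal_transformation (w \<circ> \<sigma>)"
      by (intro orthogonal_transformation_compose w'(1) \<sigma>(1))
    have "companion_basis \<Phi> B (\<lambda>x. \<epsilon> x *\<^sub>R (w \<circ> \<sigma>) (\<gamma> x))"
      by (rule companion_basis_image[OF \<Phi> \<gamma> orth image \<epsilon>])
    then show "\<gamma>' \<in> {\<gamma>'. companion_basis \<Phi> B \<gamma>'}" by (simp add: \<gamma>')
  qed
qed

end
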